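(* Let $L$ be a nonempty set, let $\mathcal C$ be the set of consequence operators on $L$, and let $C,C_1\in\mathcal C$ with $I<C<C_1$. Then an operator $C'\in\mathcal C$ is a complement of $C$ relative to $C_1$ with respect to $\vee$ (that is, $C\vee C'=C_1$ and $C\wedge C'=I$) if and only if $C'(A)=(C_1(A)\setminus C(A))\cup A$ for every $A\subseteq L$.
   Context: A consequence operator on a nonempty set $L$ is a map $C\colon\mathcal P(L)\to\mathcal P(L)$ such that for all $X,Y\subseteq L$: $X\subseteq C(X)=C(C(X))\subseteq L$, and $X\subseteq Y$ implies $C(X)\subseteq C(Y)$. $C_1\le C_2$ iff $C_1(X)\subseteq C_2(X)$ for all $X$; $<$ means $\le$ and $\ne$. $I$ is the identity on $\mathcal P(L)$. $(C_1\wedge C_2)(X)=C_1(X)\cap C_2(X)$ and $(C_1\vee C_2)(X)=C_1(X)\cup C_2(X)$. *)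

theory Defs
  imports "HOL-Library.FuncSet"
begin

text \<open>Operators on the power set of a carrier \<open>L\<close> are modelled as extensional functions on
  \<open>Pow L\<close>, so that equality of operators on \<open>L\<close> is HOL equality.\<close>

definition consequence_operators :: "'a set \<Rightarrow> ('a set \<Rightarrow> 'a set) set" where
  "consequence_operators L =
     {C \<in> Pow L \<rightarrow>\<^sub>E Pow L.
        (\<forall>X\<in>Pow L. X \<subseteq> C X \<and> C X = C (C X)) \<and>
        (\<forall>X\<in>Pow L. \<forall>Y\<in>Pow L. X \<subseteq> Y \<longrightarrow> C X \<subseteq> C Y)}"

definition op_le :: "'a set \<Rightarrow> ('a set \<Rightarrow> 'a set) \<Rightarrow> ('a set \<Rightarrow> 'a set) \<Rightarrow> bool" where
  "op_le L C\<^sub>1 C\<^sub>2 \<longleftrightarrow> (\<forall>X\<in>Pow L. C\<^sub>1 X \<subseteq> C\<^sub>2 X)"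

definition op_less :: "'a set \<Rightarrow> ('a set \<Rightarrow> 'a set) \<Rightarrow> ('a set \<Rightarrow> 'a set) \<Rightarrow> bool" where
  "op_less L C\<^sub>1 C\<^sub>2 \<longleftrightarrow> op_le L C\<^sub>1 C\<^sub>2 \<and> C\<^sub>1 \<noteq> C\<^sub>2"

definition op_id :: "'a set \<Rightarrow> 'a set \<Rightarrow> 'a set" where
  "op_id L = (\<lambda>X\<in>Pow L. X)"

definition op_meet ::
    "'a set \<Rightarrow> ('a set \<Rightarrow> 'a set) \<Rightarrow> ('a set \<Rightarrow> 'a set) \<Rightarrow> 'a set \<Rightarrow> 'a set" where
  "op_meet L C\<^sub>1 C\<^sub>2 = (\<lambda>X\<in>Pow L. C\<^sub>1 X \<inter> C\<^sub>2 X)"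

text \<open>The pointwise union of two consequence operators need not be idempotent, hence need not be
  a consequence operator.\<close>

definition op_join ::
    "'a set \<Rightarrow> ('a set \<Rightarrow> 'a set) \<Rightarrow> ('a set \<Rightarrow> 'a set) \<Rightarrow> 'a set \<Rightarrow> 'a set" where
  "op_join L C\<^sub>1 C\<^sub>2 = (\<lambda>X\<in>Pow L. C\<^sub>1 X \<union> C\<^sub>2 X)"

definition relative_complement ::
    "'a set \<Rightarrow> ('a set \<Rightarrow> 'a set) \<Rightarrow> ('a set \<Rightarrow> 'a set) \<Rightarrow> ('a set \<Rightarrow> 'a set) \<Rightarrow> bool" where
  "relative_complement L C\<^sub>1 C C' \<longleftrightarrow>
     op_join L C C' = C\<^sub>1 \<and> op_meet L C C' = op_id L"

end

theory Submission
  imports Defs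
begin

text \<open>Both sides can be compared one set \<open>A\<close> at a time. A set is determined by
  its parts inside and outside \<open>C A\<close>: the meet condition says that the part of
  \<open>C' A\<close> inside is \<open>A\<close>, and the join condition forces the part outside to
  be \<open>C\<^sub>1 A - C A\<close>. So \<open>C' A\<close> must be the union of these parts.
  \<open>relative_complement_iff\<close> supplies the passage to single sets.\<close>

lemma restrict_eq_iff:
  assumes "g \<in> extensional A"
  shows "restrict f A = g \<longleftrightarrow> (\<forall>x\<in>A. f x = g x)"
  using assms by (metis extensionalityI restrict_apply' restrict_extensional)

text \<open>Join, meet and identity are restrictions to \<open>Pow L\<close>, and
  \<open>C\<^sub>1\<close> is extensional there, so values outside \<open>Pow L\<close> cannot spoil
  equality of operators.\<close>

lemma relative_complement_iff:
  assumes "C\<^sub>1 \<in> consequence_operators L"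
  shows "relative_complement L C\<^sub>1 C C' \<longleftrightarrow>
           (\<forall>A\<in>Pow L. C A \<union> C' A = C\<^sub>1 A \<and> C A \<inter> C' A = A)"
proof -
  have "C\<^sub>1 \<in> extensional (Pow L)"
    using assms by (auto simp: consequence_operators_def PiE_def)
  then show ?thesis
    unfolding relative_complement_def op_join_def op_meet_def op_id_def
    by (simp add: restrict_eq_iff) blast
qed

theorem theorem3p3:
  fixes L :: "'a set" and C C\<^sub>1 C' :: "'a set \<Rightarrow> 'a set"
  assumes "L \<noteq> {}"
    and "C \<in> consequence_operators L"
    and "C\<^sub>1 \<in> consequence_operators L"
    and "op_less L (op_id L) C"
    and "op_less L C C\<^sub>1"
    and "C' \<in> consequence_operators L"
  shows "relative_complement L C\<^sub>1 C C' \<longleftrightarrow> (\<forall>A\<in>Pow L. C' A = (C\<^sub>1 A - C A) \<union> A)"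
  unfolding relative_complement_iff[OF assms(3)]
proof (rule ball_cong[OF refl])
  fix A assume A: "A \<in> Pow L"
  \<comment> \<open>For the converse, this inclusion makes the formula meet \<open>C A\<close> in
    exactly \<open>A\<close>; the next one makes its union with \<open>C A\<close> fill
    \<open>C\<^sub>1 A\<close>.\<close>
  have "A \<subseteq> C A"
    using A assms(2) by (simp add: consequence_operators_def)
  moreover have "C A \<subseteq> C\<^sub>1 A"
    using A assms(5) by (simp add: op_less_def op_le_def)
  ultimately show "(C A \<union> C' A = C\<^sub>1 A \<and> C A \<inter> C' A = A) \<longleftrightarrow> C' A = (C\<^sub>1 A - C A) \<union> A"
    by blast
qed

end
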